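(* Let $a<0<b$, let $N\ge 0$ be an integer, and put $J=2N+1$. Let $f_1,\dots,f_J\in C^1((a,b),\mathbb{R})$ with $f_j\equiv 0$ for $j$ even, and $$x f_j'(x)+(j-1)f_j(x)\ge 0\qquad\text{for all } j \text{ odd},\ 1\le j\le J,\ \text{and all } x\in(a,b).$$ Assume that there exists a sequence $x_m\in(a,b)$ converging to $0$ such that for every $m$ there exists $j(m)$ with $1\le j(m)\le J$ satisfying $x_m f_{j(m)}'(x_m)+(j(m)-1)f_{j(m)}(x_m)\neq 0$. Then the system $$\dot x=y,\qquad \dot y=-x-y\sum_{k=0}^{N}f_{2k+1}(x)\,y^{2k}$$ has at most one limit cycle in $(a,b)\times\mathbb{R}$, and if such a limit cycle exists it is hyperbolic.
   Context: A cycle is the orbit of a non-constant periodic solution; a limit cycle is an isolated cycle. A $T$-periodic cycle $\gamma(t)$ of a planar system $\dot x=P(x,y)$, $\dot y=Q(x,y)$ is hyperbolic if $\int_0^T \left(\frac{\partial P}{\partial x}+\frac{\partial Q}{\partial y}\right)(\gamma(t))\,dt\neq 0$. *)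

theory Defs
  imports "HOL-Analysis.Analysis"
begin

text \<open>Planar autonomous systems \<open>x' = P x y\<close>, \<open>y' = Q x y\<close> on a domain \<open>D\<close>;
  only the values of \<open>P\<close> and \<open>Q\<close> on \<open>D\<close> matter for the solutions.\<close>

definition planar_solution ::
  "(real \<Rightarrow> real \<Rightarrow> real) \<Rightarrow> (real \<Rightarrow> real \<Rightarrow> real) \<Rightarrow> (real \<times> real) set \<Rightarrow> (real \<Rightarrow> real \<times> real) \<Rightarrow> bool"
where
  "planar_solution P Q D \<gamma> \<longleftrightarrow>
     (\<forall>t. \<gamma> t \<in> D \<and>
       (\<gamma> has_vector_derivative
         (P (fst (\<gamma> t)) (snd (\<gamma> t)), Q (fst (\<gamma> t)) (snd (\<gamma> t)))) (at t))"

text \<open>The period \<open>T\<close> is not required to be minimal.\<close>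

definition periodic_cycle_param ::
  "(real \<Rightarrow> real \<Rightarrow> real) \<Rightarrow> (real \<Rightarrow> real \<Rightarrow> real) \<Rightarrow> (real \<times> real) set \<Rightarrow> real \<Rightarrow> (real \<Rightarrow> real \<times> real) \<Rightarrow> bool"
where
  "periodic_cycle_param P Q D T \<gamma> \<longleftrightarrow>
     planar_solution P Q D \<gamma> \<and> T > 0 \<and> (\<forall>t. \<gamma> (t + T) = \<gamma> t) \<and> \<not> \<gamma> constant_on UNIV"

definition is_cycle ::
  "(real \<Rightarrow> real \<Rightarrow> real) \<Rightarrow> (real \<Rightarrow> real \<Rightarrow> real) \<Rightarrow> (real \<times> real) set \<Rightarrow> (real \<times> real) set \<Rightarrow> bool"
where
  "is_cycle P Q D C \<longleftrightarrow> (\<exists>T \<gamma>. periodic_cycle_param P Q D T \<gamma> \<and> C = range \<gamma>)"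

definition is_limit_cycle ::
  "(real \<Rightarrow> real \<Rightarrow> real) \<Rightarrow> (real \<Rightarrow> real \<Rightarrow> real) \<Rightarrow> (real \<times> real) set \<Rightarrow> (real \<times> real) set \<Rightarrow> bool"
where
  "is_limit_cycle P Q D C \<longleftrightarrow>
     is_cycle P Q D C \<and>
     (\<exists>U. open U \<and> C \<subseteq> U \<and> (\<forall>C'. is_cycle P Q D C' \<and> C' \<subseteq> U \<longrightarrow> C' = C))"

definition planar_divergence ::
  "(real \<Rightarrow> real \<Rightarrow> real) \<Rightarrow> (real \<Rightarrow> real \<Rightarrow> real) \<Rightarrow> real \<times> real \<Rightarrow> real"
where
  "planar_divergence P Q p =
     deriv (\<lambda>x. P x (snd p)) (fst p) + deriv (\<lambda>y. Q (fst p) y) (snd p)"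

text \<open>The condition is imposed for every parametrisation of the cycle and every period; this
  costs nothing when solutions are unique, since time shifts leave the integral over one period
  unchanged and passing to a multiple of the minimal period multiplies it by a positive integer.\<close>

definition is_hyperbolic_cycle ::
  "(real \<Rightarrow> real \<Rightarrow> real) \<Rightarrow> (real \<Rightarrow> real \<Rightarrow> real) \<Rightarrow> (real \<times> real) set \<Rightarrow> (real \<times> real) set \<Rightarrow> bool"
where
  "is_hyperbolic_cycle P Q D C \<longleftrightarrow>
     is_cycle P Q D C \<and>
     (\<forall>T \<gamma>. periodic_cycle_param P Q D T \<gamma> \<and> range \<gamma> = C \<longrightarrow>
        integral {0..T} (\<lambda>t. planar_divergence P Q (\<gamma> t)) \<noteq> 0)"

end

theory Submission
  imports Defs "HOL-Library.Periodic_Fun"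
begin

text \<open>Write the system as \<open>x' = y\<close>, \<open>y' = -x - y F(x, y)\<close>. The hypotheses say that \<open>F\<close> is
  nondecreasing along rays from the origin, i.e. \<open>H = x F\<^sub>x + y F\<^sub>y \<ge> 0\<close>, with \<open>H > 0\<close> off the
  \<open>x\<close>-axis on vertical lines arbitrarily close to the \<open>y\<close>-axis; every cycle meets such a line.

  Along a cycle the quantity \<open>S = x\<^sup>2 + y\<^sup>2 + x y F\<close>, which is \<open>r\<^sup>2\<close> times the clockwise angular
  velocity, satisfies \<open>S' = div S + y\<^sup>2 H\<close>. Hence \<open>S exp (-\<integral> div)\<close> is nondecreasing; since \<open>S\<close> is
  periodic and positive on the \<open>y\<close>-axis, it is positive everywhere, and comparing its values one
  period apart gives \<open>\<integral> div < 0\<close>.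

  As the angular velocity does not vanish, a cycle is a graph \<open>log r = R \<theta>\<close> with
  \<open>R' = -sin\<^sup>2 \<theta> F / (1 - sin \<theta> cos \<theta> F)\<close>, which is decreasing in \<open>F\<close>. For two cycles monotonicity
  of \<open>F\<close> along rays therefore makes \<open>(R\<^sub>1 - R\<^sub>2)\<^sup>2\<close> nonincreasing, hence constant by periodicity, and
  a nonzero constant is impossible at a point where \<open>H > 0\<close> and \<open>y \<noteq> 0\<close>.\<close>

section \<open>Periodic functions, maxima and simple zeros on the real line\<close>

lemma continuous_has_antiderivative:
  fixes f :: "real \<Rightarrow> 'a::euclidean_space"
  assumes "\<And>t. isCont f t"
  obtains A where "\<And>t. (A has_vector_derivative f t) (at t)"
  using einterval_antiderivative[of "-\<infinity>" "\<infinity>" f] assms by auto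

text \<open>Shifting \<open>t\<close> by a whole number of periods,
  \<open>\<lfloor>(u - t) / T\<rfloor>\<close> of them, brings it below \<open>u\<close>. This lets
  a monotonicity statement carry any value of a periodic function forward to a prescribed
  time.\<close>

lemma periodic_representative:
  fixes f :: "real \<Rightarrow> 'a"
  assumes "T > 0" "\<And>t. f (t + T) = f t"
  obtains s where "s \<le> u" "f s = f t"
proof -
  interpret periodic_fun_simple f T by standard (rule assms)
  let ?n = "\<lfloor>(u - t) / T\<rfloor>"
  have "of_int ?n * T \<le> u - t"
    using assms(1) by (simp flip: pos_le_divide_eq)
  then show thesis using that[of "t + of_int ?n * T"] plus_of_int[of t ?n] by simp
qed

lemma periodic_representative_in_period:
  fixes f :: "real \<Rightarrow> 'a"
  assumes "T > 0" "\<And>t. f (t + T) = f t"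
  obtains s where "0 \<le> s" "s < T" "f s = f t"
proof -
  interpret periodic_fun_simple f T by standard (rule assms)
  let ?n = "\<lfloor>t / T\<rfloor>"
  have "of_int ?n \<le> t / T" "t / T < of_int ?n + 1" by linarith+
  then have "of_int ?n * T \<le> t" "t < (of_int ?n + 1) * T"
    using assms(1) by (simp_all only: pos_le_divide_eq pos_divide_less_eq)
  then show thesis using that[of "t - of_int ?n * T"] minus_of_int[of t ?n]
    by (simp add: algebra_simps)
qed

lemma periodic_attains_max:
  fixes f :: "real \<Rightarrow> real"
  assumes "T > 0" "\<And>t. f (t + T) = f t" "\<And>t. isCont f t"
  obtains s where "\<And>t. f t \<le> f s"
proof -
  have "continuous_on {0..T} f" using assms(3) by (simp add: continuous_at_imp_continuous_on)
  then obtain s where s: "\<forall>t\<in>{0..T}. f t \<le> f s"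
    using continuous_attains_sup[of "{0..T}" f] assms(1) by auto
  have "f t \<le> f s" for t
  proof -
    obtain u where "0 \<le> u" "u < T" "f u = f t"
      using periodic_representative_in_period[of T f t] assms by blast
    then show ?thesis using s by (metis atLeastAtMost_iff less_imp_le)
  qed
  then show thesis by (rule that)
qed

text \<open>If \<open>c\<close> were positive, \<open>v\<close> would be positive just after
  \<open>s\<close>, and \<open>x\<close> would rise above its maximum there.\<close>

lemma second_derivative_at_max:
  fixes x v :: "real \<Rightarrow> real"
  assumes x: "\<And>t. (x has_real_derivative v t) (at t)"
    and v: "(v has_real_derivative c) (at s)"
    and max: "\<And>t. x t \<le> x s"
  shows "v s = 0" "c \<le> 0"
proof -
  show vs: "v s = 0" using DERIV_local_max[OF x, of 1 s] max by simp
  show "c \<le> 0"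
  proof (rule ccontr)
    assume "\<not> c \<le> 0"
    then obtain d where d: "d > 0" "\<And>h. 0 < h \<Longrightarrow> h < d \<Longrightarrow> v s < v (s + h)"
      using DERIV_pos_inc_right[OF v] by auto
    have pos: "v t > 0" if "s < t" "t < s + d / 2" for t
      using d(2)[of "t - s"] that vs d(1) by simp
    have "x s < x (s + d / 2)"
    proof (rule DERIV_pos_imp_increasing_open[where f = x])
      show "\<exists>y. (x has_real_derivative y) (at t) \<and> 0 < y" if "s < t" "t < s + d / 2" for t
        using x pos that by blast
      show "continuous_on {s..s + d / 2} x"
        using x DERIV_isCont by (blast intro: continuous_at_imp_continuous_on)
    qed (use d in auto)
    then show False using max[of "s + d / 2"] by simp
  qed
qed

text \<open>A simple zero is a sign change, so \<open>f\<close> takes both signs within any distance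
  of \<open>s\<close>. Late terms of \<open>X\<close> lie between two such values, and the
  intermediate value theorem applies.\<close>

lemma hits_sequence_near_simple_zero_pos:
  fixes f :: "real \<Rightarrow> real" and X :: "nat \<Rightarrow> real"
  assumes cont: "\<And>t. isCont f t" and f: "(f has_real_derivative c) (at s)" "c > 0" "f s = 0"
    and X: "X \<longlonglongrightarrow> 0" and e: "e > 0"
  obtains t m where "\<bar>t - s\<bar> < e" "f t = X m"
proof -
  obtain d1 where d1: "d1 > 0" "\<And>h. 0 < h \<Longrightarrow> h < d1 \<Longrightarrow> f s < f (s + h)"
    using DERIV_pos_inc_right[OF f(1,2)] by auto
  obtain d2 where d2: "d2 > 0" "\<And>h. 0 < h \<Longrightarrow> h < d2 \<Longrightarrow> f (s - h) < f s"
    using DERIV_pos_inc_left[OF f(1,2)] by auto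
  define h where "h = min e (min d1 d2) / 2"
  have h: "0 < h" "h < e" "h < d1" "h < d2" using e d1 d2 by (auto simp: h_def)
  have "f (s - h) < 0" "0 < f (s + h)" using d1(2) d2(2) h f(3) by fastforce+
  then have "eventually (\<lambda>m. f (s - h) < X m \<and> X m < f (s + h)) sequentially"
    using order_tendstoD[OF X] by (simp add: eventually_conj)
  then obtain m where "f (s - h) \<le> X m" "X m \<le> f (s + h)"
    by (metis (mono_tags, lifting) eventually_happens' sequentially_bot less_imp_le)
  then obtain t where "s - h \<le> t" "t \<le> s + h" "f t = X m"
    using IVT[of f "s - h" "X m" "s + h"] cont h by auto
  then show thesis using that[of t m] h by auto
qed

lemma hits_sequence_near_simple_zero:
  fixes f :: "real \<Rightarrow> real" and X :: "nat \<Rightarrow> real"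
  assumes cont: "\<And>t. isCont f t" and f: "(f has_real_derivative c) (at s)" "c \<noteq> 0" "f s = 0"
    and X: "X \<longlonglongrightarrow> 0" and e: "e > 0"
  obtains t m where "\<bar>t - s\<bar> < e" "f t = X m"
proof (cases "c > 0")
  case True
  then show ?thesis using hits_sequence_near_simple_zero_pos[OF assms(1,2) _ f(3) X e] that by blast
next
  case False
  then have "- c > 0" using f by simp
  moreover have "((\<lambda>t. - f t) has_real_derivative - c) (at s)" using f by (auto intro!: derivative_intros)
  moreover have "(\<lambda>m. - X m) \<longlonglongrightarrow> 0" using tendsto_minus[OF X] by simp
  ultimately obtain t m where "\<bar>t - s\<bar> < e" "- f t = - X m"
    using hits_sequence_near_simple_zero_pos[of "\<lambda>t. - f t" "- c" s "\<lambda>m. - X m" e] cont f e by auto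
  then show ?thesis using that by auto
qed

subsection \<open>Monotonicity along rays\<close>

text \<open>The argument runs for a general damping \<open>F\<close>; the polynomial in
  \<open>y\<close> is substituted only in the final theorem. There the radial derivative at
  \<open>v = 0\<close> reduces to its \<open>k = 0\<close> term, which may vanish, hence the
  restriction in \<open>radial_pos\<close>.\<close>

locale lienard_system =
  fixes a b :: real and F Fx Fy :: "real \<Rightarrow> real \<Rightarrow> real" and X :: "nat \<Rightarrow> real"
  assumes F_derivative: "\<And>u v. u \<in> {a<..<b} \<Longrightarrow>
      ((\<lambda>p. F (fst p) (snd p)) has_derivative (\<lambda>h. Fx u v * fst h + Fy u v * snd h)) (at (u, v))"
    and Fy_continuous: "continuous_on ({a<..<b} \<times> UNIV) (\<lambda>p. Fy (fst p) (snd p))"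
    and radial_nonneg: "\<And>u v. u \<in> {a<..<b} \<Longrightarrow> 0 \<le> u * Fx u v + v * Fy u v"
    and X_tendsto: "X \<longlonglongrightarrow> 0"
    and radial_pos: "\<And>m v. v \<noteq> 0 \<Longrightarrow> 0 < X m * Fx (X m) v + v * Fy (X m) v"
begin

lemma F_along:
  assumes "u t \<in> {a<..<b}" "(u has_real_derivative u') (at t)" "(v has_real_derivative v') (at t)"
  shows "((\<lambda>t. F (u t) (v t)) has_real_derivative Fx (u t) (v t) * u' + Fy (u t) (v t) * v') (at t)"
proof -
  have d: "((\<lambda>t. (u t, v t)) has_derivative (\<lambda>h. (h * u', h * v'))) (at t)"
    using assms(2,3) by (auto simp: has_field_derivative_def mult_commute_abs intro!: has_derivative_Pair)
  have "((\<lambda>t. F (fst (u t, v t)) (snd (u t, v t))) has_derivative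
     (\<lambda>h. Fx (u t) (v t) * fst (h * u', h * v') + Fy (u t) (v t) * snd (h * u', h * v'))) (at t)"
    by (rule has_derivative_compose[OF d F_derivative[OF assms(1), of "v t"]])
  then show ?thesis
    unfolding has_field_derivative_def fst_conv snd_conv
    by (rule has_derivative_eq_rhs) (auto simp: algebra_simps)
qed

text \<open>The derivative of F(s u, s v) in s, multiplied by s, is the radial derivative at (s u, s
  v), hence nonnegative. A positive derivative at s = 1 gives an initial strict increase, which
  monotonicity preserves up to \<open>l\<close>.\<close>

lemma F_ray:
  assumes "u \<in> {a<..<b}" "1 \<le> l" "l * u \<in> {a<..<b}"
  shows "F u v \<le> F (l * u) (l * v)"
    and "1 < l \<Longrightarrow> 0 < u * Fx u v + v * Fy u v \<Longrightarrow> F u v < F (l * u) (l * v)"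
proof -
  let ?g = "\<lambda>s. F (s * u) (s * v)" and ?g' = "\<lambda>s. Fx (s * u) (s * v) * u + Fy (s * u) (s * v) * v"
  have dom: "s * u \<in> {a<..<b}" if "1 \<le> s" "s \<le> l" for s
  proof (cases "u \<ge> 0")
    case True
    then have "u * 1 \<le> u * s" "u * s \<le> u * l" using that mult_left_mono[of 1 s u] mult_left_mono[of s l u] by simp_all
    then show ?thesis using assms by (simp add: mult.commute)
  next
    case False
    then have "u * s \<le> u * 1" "u * l \<le> u * s" using that mult_left_mono_neg[of 1 s u] mult_left_mono_neg[of s l u] by simp_all
    then show ?thesis using assms by (simp add: mult.commute)
  qed
  have deriv: "(?g has_real_derivative ?g' s) (at s)" if "1 \<le> s" "s \<le> l" for s
    using that by (intro F_along[of "\<lambda>s. s * u" s u "\<lambda>s. s * v" v]) (use dom in \<open>auto intro!: derivative_eq_intros\<close>)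
  have nonneg: "0 \<le> ?g' s" if "1 \<le> s" "s \<le> l" for s
  proof -
    have "0 \<le> s * ?g' s" using radial_nonneg[OF dom[OF that], of "s * v"] by (simp add: algebra_simps)
    then show ?thesis using that by (simp add: zero_le_mult_iff)
  qed
  have mono: "?g s \<le> ?g l" if "1 \<le> s" "s \<le> l" for s
  proof (rule DERIV_nonneg_imp_nondecreasing[where f = ?g, OF that(2)])
    fix r assume "s \<le> r" "r \<le> l"
    then have "1 \<le> r" using that by simp
    then show "\<exists>d. (?g has_real_derivative d) (at r) \<and> 0 \<le> d"
      using deriv nonneg \<open>r \<le> l\<close> by blast
  qed
  show "F u v \<le> F (l * u) (l * v)" using mono[of 1] assms by simp
  assume l: "1 < l" and pos: "0 < u * Fx u v + v * Fy u v"
  have "?g' 1 > 0" using pos by (simp add: algebra_simps)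
  then obtain d where d: "d > 0" "\<And>h. 0 < h \<Longrightarrow> h < d \<Longrightarrow> ?g 1 < ?g (1 + h)"
    using DERIV_pos_inc_right[OF deriv[of 1]] l by auto
  define h where "h = min d (l - 1) / 2"
  have h: "0 < h" "h < d" "1 + h \<le> l" using d(1) l by (auto simp: h_def min_def field_simps)
  have "?g 1 < ?g (1 + h)" using d(2) h by blast
  also have "\<dots> \<le> ?g l" using mono[of "1 + h"] h by simp
  finally show "F u v < F (l * u) (l * v)" by simp
qed

end

subsection \<open>Rotation and hyperbolicity of cycles\<close>

locale lienard_cycle = lienard_system +
  fixes x y :: "real \<Rightarrow> real" and T :: real
  assumes x_derivative: "\<And>t. (x has_real_derivative y t) (at t)"
    and y_derivative: "\<And>t. (y has_real_derivative - x t - y t * F (x t) (y t)) (at t)"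
    and x_in: "\<And>t. x t \<in> {a<..<b}"
    and T_pos: "T > 0"
    and x_periodic: "\<And>t. x (t + T) = x t" and y_periodic: "\<And>t. y (t + T) = y t"
    and not_constant: "\<exists>s t. (x s, y s) \<noteq> (x t, y t)"
begin

definition S :: "real \<Rightarrow> real" where
  "S t = (x t)\<^sup>2 + (y t)\<^sup>2 + x t * y t * F (x t) (y t)"

definition divergence :: "real \<Rightarrow> real" where
  "divergence t = - (F (x t) (y t) + y t * Fy (x t) (y t))"

definition radial_growth :: "real \<Rightarrow> real" where
  "radial_growth t = x t * Fx (x t) (y t) + y t * Fy (x t) (y t)"

lemma isCont_x: "isCont x t" and isCont_y: "isCont y t"
  using x_derivative y_derivative DERIV_isCont by blast+

lemma F_derivative_along:
  "((\<lambda>t. F (x t) (y t)) has_real_derivative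
     Fx (x t) (y t) * y t + Fy (x t) (y t) * (- x t - y t * F (x t) (y t))) (at t)"
  by (intro F_along x_in x_derivative y_derivative)

lemma isCont_F: "isCont (\<lambda>t. F (x t) (y t)) t"
  using F_derivative_along DERIV_isCont by blast

lemma isCont_divergence: "isCont divergence t"
proof -
  have "continuous_on UNIV ((\<lambda>p. Fy (fst p) (snd p)) \<circ> (\<lambda>t. (x t, y t)))"
    using x_in isCont_x isCont_y
    by (intro continuous_on_compose continuous_on_subset[OF Fy_continuous] continuous_on_Pair)
       (auto simp: continuous_at_imp_continuous_on)
  then have "isCont (\<lambda>t. Fy (x t) (y t)) t" by (simp add: o_def continuous_on_eq_continuous_at)
  then show ?thesis unfolding divergence_def[abs_def] by (intro continuous_intros isCont_F isCont_y)
qed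

text \<open>Since \<open>w = x\<^sup>2 + y\<^sup>2\<close> satisfies \<open>\<bar>w'\<bar> \<le> 2 \<bar>F\<bar> w\<close>, a zero of \<open>w\<close> would force \<open>w = 0\<close> everywhere.\<close>

lemma not_origin: "(x t)\<^sup>2 + (y t)\<^sup>2 > 0"
proof (rule ccontr)
  let ?w = "\<lambda>t. (x t)\<^sup>2 + (y t)\<^sup>2" and ?F = "\<lambda>t. F (x t) (y t)"
  assume "\<not> ?w t > 0"
  then have t: "?w t = 0" using sum_power2_ge_zero[of "x t" "y t"] by linarith
  have "isCont (\<lambda>t. 2 * \<bar>?F t\<bar>) s" for s by (intro continuous_intros isCont_F)
  \<comment> \<open>With this integrating factor w exp(-A) is nonincreasing and w exp(A) is
    nondecreasing. The first forces w = 0 after \<open>t\<close>, the second before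
    \<open>t\<close>.\<close>
  then obtain A where A: "\<And>s. (A has_real_derivative 2 * \<bar>?F s\<bar>) (at s)"
    using continuous_has_antiderivative[of "\<lambda>t. 2 * \<bar>?F t\<bar>"]
    by (auto simp: has_real_derivative_iff_has_vector_derivative)
  have w: "(?w has_real_derivative - 2 * (y s)\<^sup>2 * ?F s) (at s)" for s
    by (rule derivative_eq_intros x_derivative y_derivative refl)+ (simp add: power2_eq_square algebra_simps)
  have bound: "\<bar>2 * (y s)\<^sup>2 * ?F s\<bar> \<le> 2 * \<bar>?F s\<bar> * ?w s" for s
    by (auto simp: abs_mult algebra_simps)
  have "?w s \<le> 0" for s
  proof (cases "t \<le> s")
    case True
    have "?w s * exp (- A s) \<le> ?w t * exp (- A t)"
    proof (rule DERIV_nonpos_imp_nonincreasing[OF True], intro exI conjI)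
      fix u
      show "((\<lambda>s. ?w s * exp (- A s)) has_real_derivative
        (- 2 * (y u)\<^sup>2 * ?F u - 2 * \<bar>?F u\<bar> * ?w u) * exp (- A u)) (at u)"
        by (rule derivative_eq_intros w A refl)+ (simp add: algebra_simps)
      have "- 2 * (y u)\<^sup>2 * ?F u - 2 * \<bar>?F u\<bar> * ?w u \<le> 0" using bound[of u] by linarith
      then show "(- 2 * (y u)\<^sup>2 * ?F u - 2 * \<bar>?F u\<bar> * ?w u) * exp (- A u) \<le> 0"
        by (simp add: mult_le_0_iff)
    qed
    then show ?thesis unfolding t by (simp add: mult_le_0_iff del: sum_power2_le_zero_iff)
  next
    case False
    then have le: "s \<le> t" by simp
    have "?w s * exp (A s) \<le> ?w t * exp (A t)"
    proof (rule DERIV_nonneg_imp_nondecreasing[OF le], intro exI conjI)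
      fix u
      show "((\<lambda>s. ?w s * exp (A s)) has_real_derivative
        (- 2 * (y u)\<^sup>2 * ?F u + 2 * \<bar>?F u\<bar> * ?w u) * exp (A u)) (at u)"
        by (rule derivative_eq_intros w A refl)+ (simp add: algebra_simps)
      have "- 2 * (y u)\<^sup>2 * ?F u + 2 * \<bar>?F u\<bar> * ?w u \<ge> 0" using bound[of u] by linarith
      then show "(- 2 * (y u)\<^sup>2 * ?F u + 2 * \<bar>?F u\<bar> * ?w u) * exp (A u) \<ge> 0"
        by (simp add: zero_le_mult_iff)
    qed
    then show ?thesis unfolding t by (simp add: mult_le_0_iff del: sum_power2_le_zero_iff)
  qed
  then have "x s = 0 \<and> y s = 0" for s by (simp add: sum_power2_le_zero_iff)
  then show False using not_constant by simp
qed

text \<open>Where x is maximal, y = 0 and x'' = -x, so x is nonnegative there; likewise x is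
  nonpositive at its minimum. A zero lies in between, and y cannot vanish with x since the orbit
  avoids the origin.\<close>

lemma crosses_vertical_axis: obtains t where "x t = 0" "y t \<noteq> 0"
proof -
  obtain s where s: "\<And>t. x t \<le> x s"
    using periodic_attains_max[OF T_pos x_periodic isCont_x] by blast
  have "y s = 0" "- x s - y s * F (x s) (y s) \<le> 0"
    using second_derivative_at_max[OF x_derivative y_derivative s] by auto
  then have xs: "0 \<le> x s" by simp
  obtain r where r: "\<And>t. - x t \<le> - x r"
    using periodic_attains_max[of T "\<lambda>t. - x t"] T_pos x_periodic isCont_x by (metis isCont_minus)
  have "- y r = 0" "- (- x r - y r * F (x r) (y r)) \<le> 0"
    using second_derivative_at_max[OF DERIV_minus[OF x_derivative] DERIV_minus[OF y_derivative] r] by auto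
  then have xr: "x r \<le> 0" by simp
  have "\<exists>t. x t = 0"
    using IVT[of x r 0 s] IVT2[of x r 0 s] IVT[of x s 0 r] IVT2[of x s 0 r] xs xr isCont_x
    by (cases "r \<le> s") auto
  then obtain t where "x t = 0" by blast
  then show thesis using that[of t] not_origin[of t] by auto
qed

text \<open>On the vertical axis x' = y is nonzero, so x has a simple zero and passes through some
  \<open>X m\<close> so close by that y is still nonzero.\<close>

lemma strict_point: obtains t where "y t \<noteq> 0" "radial_growth t > 0"
proof -
  obtain s where s: "x s = 0" "y s \<noteq> 0" by (rule crosses_vertical_axis)
  then obtain e where e: "e > 0" "\<And>t. \<bar>t - s\<bar> < e \<Longrightarrow> y t \<noteq> 0"
    using continuous_at_avoid[OF isCont_y, of s 0] by (auto simp: dist_real_def abs_minus_commute)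
  obtain t m where "\<bar>t - s\<bar> < e" "x t = X m"
    using hits_sequence_near_simple_zero[OF isCont_x x_derivative s(2,1) X_tendsto e(1)] by blast
  then show thesis using that[of t] e(2) radial_pos by (auto simp: radial_growth_def)
qed

lemma S_derivative: "(S has_real_derivative divergence t * S t + (y t)\<^sup>2 * radial_growth t) (at t)"
  unfolding S_def[abs_def]
  by (rule derivative_eq_intros x_derivative y_derivative F_derivative_along refl)+
     (simp add: S_def divergence_def radial_growth_def power2_eq_square algebra_simps)

lemma weighted_S:
  assumes A: "\<And>t. (A has_real_derivative divergence t) (at t)"
  shows "((\<lambda>t. S t * exp (- A t)) has_real_derivative (y t)\<^sup>2 * radial_growth t * exp (- A t)) (at t)"
    and "s \<le> t \<Longrightarrow> S s * exp (- A s) \<le> S t * exp (- A t)"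
proof -
  show D: "((\<lambda>t. S t * exp (- A t)) has_real_derivative (y t)\<^sup>2 * radial_growth t * exp (- A t)) (at t)" for t
    by (rule derivative_eq_intros S_derivative A refl)+ (simp add: algebra_simps)
  have "0 \<le> (y t)\<^sup>2 * radial_growth t * exp (- A t)" for t
    using radial_nonneg[OF x_in] by (simp add: radial_growth_def)
  then show "s \<le> t \<Longrightarrow> S s * exp (- A s) \<le> S t * exp (- A t)"
    using D by (intro DERIV_nonneg_imp_nondecreasing[of s t "\<lambda>t. S t * exp (- A t)"]) blast+
qed

lemma divergence_antiderivative: obtains A where "\<And>t. (A has_real_derivative divergence t) (at t)"
  using continuous_has_antiderivative[OF isCont_divergence]
  by (auto simp: has_real_derivative_iff_has_vector_derivative)

lemma S_periodic: "S (t + T) = S t"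
  by (simp add: S_def x_periodic y_periodic)

text \<open>On the vertical axis S = y^2 > 0. By periodicity this value is also taken at a time
  \<open>r\<close> before \<open>t\<close>, from which the nondecreasing weighted quantity
  transports the sign to \<open>t\<close>.\<close>

lemma S_pos: "S t > 0"
proof -
  obtain A where A: "\<And>t. (A has_real_derivative divergence t) (at t)" using divergence_antiderivative by blast
  obtain s where "x s = 0" "y s \<noteq> 0" by (rule crosses_vertical_axis)
  then have "S s > 0" by (simp add: S_def)
  moreover obtain r where r: "r \<le> t" "S r = S s"
    using periodic_representative[of T S, OF T_pos S_periodic] by blast
  ultimately have "0 < S r * exp (- A r)" by simp
  also have "\<dots> \<le> S t * exp (- A t)" by (rule weighted_S(2)[OF A r(1)])
  finally show ?thesis by (simp add: zero_less_mult_iff)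
qed

lemma divergence_integral_neg: "integral {0..T} divergence < 0"
proof -
  obtain A where A: "\<And>t. (A has_real_derivative divergence t) (at t)" using divergence_antiderivative by blast
  let ?g = "\<lambda>t. S t * exp (- A t)"
  obtain s where "y s \<noteq> 0" "radial_growth s > 0" by (rule strict_point)
  \<comment> \<open>The strict point is moved into the half-open period, so that the strict increase
    of \<open>?g\<close> just after \<open>u\<close> takes place before \<open>T\<close>.\<close>
  moreover obtain u where u: "0 \<le> u" "u < T" "(x u, y u) = (x s, y s)"
    using periodic_representative_in_period[of T "\<lambda>t. (x t, y t)" s] T_pos x_periodic y_periodic by auto
  ultimately have "0 < (y u)\<^sup>2 * radial_growth u * exp (- A u)" by (simp add: radial_growth_def)
  then obtain d where d: "d > 0" "\<And>h. 0 < h \<Longrightarrow> h < d \<Longrightarrow> ?g u < ?g (u + h)"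
    using DERIV_pos_inc_right[OF weighted_S(1)[OF A]] by blast
  define h where "h = min d (T - u) / 2"
  have h: "0 < h" "h < d" "u + h \<le> T" using d(1) u by (auto simp: h_def min_def field_simps)
  have "?g 0 \<le> ?g u" using weighted_S(2)[OF A] u by blast
  also have "\<dots> < ?g (u + h)" using d h by blast
  also have "\<dots> \<le> ?g T" using weighted_S(2)[OF A] h by blast
  \<comment> \<open>\<open>S\<close> has the same positive value at 0 and \<open>T\<close>, so it
    cancels from \<open>?g 0 < ?g T\<close>.\<close>
  finally have "A T < A 0" using S_pos[of 0] S_periodic[of 0] by simp
  moreover have "(divergence has_integral A T - A 0) {0..T}"
    using A T_pos by (intro fundamental_theorem_of_calculus)
      (auto simp: has_real_derivative_iff_has_vector_derivative has_vector_derivative_at_within)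
  ultimately show ?thesis by (simp add: integral_unique)
qed

end

subsection \<open>Cycles in polar coordinates\<close>

text \<open>The shift relation with c > 0 makes \<open>f\<close> unbounded in both directions, hence
  onto. It serves to invert the polar angle as a function of time.\<close>

lemma strictly_increasing_shift_bij:
  fixes f :: "real \<Rightarrow> real"
  assumes deriv: "\<And>t. (f has_real_derivative f' t) (at t)" and pos: "\<And>t. f' t > 0"
    and shift: "\<And>t. f (t + T) = f t + c" and T: "T > 0"
  obtains g where "\<And>s. f (g s) = s" "\<And>t. g (f t) = t"
    "\<And>s. (g has_real_derivative inverse (f' (g s))) (at s)"
proof -
  have mono: "f s < f t" if "s < t" for s t
    using DERIV_pos_imp_increasing[OF that, of f] deriv pos by blast
  then have "strict_mono f" by (rule strict_monoI)
  then have "inj f" by (rule strict_mono_imp_inj_on)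
  have c: "c > 0" using mono[of 0 T] shift[of 0] T by simp
  have nat_shift: "f (t + real n * T) = f t + real n * c" for t n
  proof (induction n)
    case (Suc n)
    then show ?case using shift[of "t + real n * T"] by (simp add: algebra_simps)
  qed simp
  have "\<exists>t. f t = s" for s
  proof -
    obtain n where n: "\<bar>s - f 0\<bar> < real n * c"
      using reals_Archimedean3[OF c] by blast
    have "f (- real n * T) \<le> s" using nat_shift[of "- real n * T" n] n by simp
    moreover have "s \<le> f (real n * T)" using nat_shift[of 0 n] n by simp
    ultimately show ?thesis
      using IVT[of f "- real n * T" s "real n * T"] T DERIV_isCont[OF deriv] by auto
  qed
  then have "surj f" unfolding surj_def by metis
  then have inv: "f (inv f s) = s" for s by (rule surj_f_inv_f)
  moreover have inv': "inv f (f t) = t" for t using \<open>inj f\<close> by simp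
  moreover have "(inv f has_real_derivative inverse (f' (inv f s))) (at s)" for s
  proof (rule DERIV_inverse_function[where f = f and a = "s - 1" and b = "s + 1"])
    show "(f has_real_derivative f' (inv f s)) (at (inv f s))" by (rule deriv)
    have "isCont (inv f) (f (inv f s))"
      by (rule isCont_inverse_function[where d = 1]) (use inv' DERIV_isCont[OF deriv] in auto)
    then show "isCont (inv f) s" by (simp add: inv)
    show "f' (inv f s) \<noteq> 0" using pos[of "inv f s"] by simp
  qed (use inv in auto)
  ultimately show thesis using inv by (intro that)
qed

text \<open>For an antiderivative A of z'/z the product z exp(-A) has derivative zero; its constant
  value is absorbed by adding \<open>Ln k\<close>. Real and imaginary parts of \<open>L\<close> give
  a global log radius and a global angle.\<close>

lemma logarithm_along_path:
  fixes z z' :: "real \<Rightarrow> complex"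
  assumes z: "\<And>t. (z has_vector_derivative z' t) (at t)" and z': "\<And>t. isCont z' t"
    and nz: "\<And>t. z t \<noteq> 0"
  obtains L where "\<And>t. exp (L t) = z t" "\<And>t. (L has_vector_derivative z' t / z t) (at t)"
proof -
  have "isCont z t" for t using z has_vector_derivative_continuous by blast
  then have "isCont (\<lambda>t. z' t / z t) t" for t using z' nz by (intro continuous_intros)
  then obtain A where A: "\<And>t. (A has_vector_derivative z' t / z t) (at t)"
    using continuous_has_antiderivative[of "\<lambda>t. z' t / z t"] by blast
  have "((\<lambda>t. exp (- A t)) has_vector_derivative - (z' t / z t) * exp (- A t)) (at t)" for t
    using field_vector_diff_chain_at[OF has_vector_derivative_minus[OF A] DERIV_exp] by (simp add: o_def)
  from has_vector_derivative_mult[OF z this]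
  have "((\<lambda>t. z t * exp (- A t)) has_vector_derivative 0) (at t)" for t
    by (simp add: nz)
  then obtain k where k: "\<And>t. z t * exp (- A t) = k"
    using has_vector_derivative_zero_constant[of UNIV "\<lambda>t. z t * exp (- A t)"] by auto
  have "k \<noteq> 0" using k[of 0] nz[of 0] by auto
  then have "exp (A t + Ln k) = z t" for t
    using k[of t] by (simp add: exp_add exp_minus field_simps)
  moreover have "((\<lambda>t. A t + Ln k) has_vector_derivative z' t / z t) (at t)" for t
    using has_vector_derivative_add[OF A has_vector_derivative_const] by simp
  ultimately show thesis by (rule that)
qed

text \<open>Every value recurs before any given time, so no value can exceed another.\<close>

lemma nondecreasing_periodic_constant:
  fixes f :: "real \<Rightarrow> real"
  assumes mono: "\<And>s t. s \<le> t \<Longrightarrow> f s \<le> f t" and "T > 0" "\<And>t. f (t + T) = f t"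
  shows "f s = f t"
proof -
  have "f t \<le> f s" for s t
  proof -
    obtain r where "r \<le> s" "f r = f t" using periodic_representative[of T f] assms(2,3) by blast
    then show ?thesis using mono[of r s] by simp
  qed
  then show ?thesis by (simp add: antisym)
qed

section \<open>Comparison of two polar graphs\<close>

context lienard_system
begin

text \<open>Here \<open>\<theta>\<close> is the clockwise polar angle and \<open>R \<theta>\<close> the logarithm of the radius. Every cycle
  has a nowhere vanishing angular velocity, so that it is the graph of such a function. The winding
  number \<open>k\<close> need not be \<open>1\<close>, because \<open>T\<close> is not assumed to be the minimal period.\<close>

definition on_ray :: "(real \<Rightarrow> real) \<Rightarrow> real \<Rightarrow> real \<times> real" where
  "on_ray R \<theta> = (exp (R \<theta>) * cos \<theta>, - exp (R \<theta>) * sin \<theta>)"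

definition F_ray_at :: "(real \<Rightarrow> real) \<Rightarrow> real \<Rightarrow> real" where
  "F_ray_at R \<theta> = F (fst (on_ray R \<theta>)) (snd (on_ray R \<theta>))"

text \<open>The denominator is the clockwise angular velocity, so the fraction is d(log
  r)/d\<theta>. The existential clause records a point where \<open>F\<close> grows strictly along
  the ray; it is what separates two graphs with a constant nonzero gap.\<close>

definition polar_cycle :: "(real \<Rightarrow> real) \<Rightarrow> nat \<Rightarrow> bool" where
  "polar_cycle R k \<longleftrightarrow> k > 0 \<and>
     (\<forall>\<theta>. R (\<theta> + 2 * pi * real k) = R \<theta> \<and> fst (on_ray R \<theta>) \<in> {a<..<b} \<and>
        0 < 1 - sin \<theta> * cos \<theta> * F_ray_at R \<theta> \<and>
        (R has_real_derivative
           - (sin \<theta>)\<^sup>2 * F_ray_at R \<theta> / (1 - sin \<theta> * cos \<theta> * F_ray_at R \<theta>)) (at \<theta>)) \<and>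
     (\<exists>\<theta>. snd (on_ray R \<theta>) \<noteq> 0 \<and>
        0 < fst (on_ray R \<theta>) * Fx (fst (on_ray R \<theta>)) (snd (on_ray R \<theta>))
          + snd (on_ray R \<theta>) * Fy (fst (on_ray R \<theta>)) (snd (on_ray R \<theta>)))"

text \<open>At a common angle the second point is the first one scaled by exp(R2 - R1), which is at
  least 1.\<close>

lemma F_ray_at_mono:
  assumes "polar_cycle R1 k1" "polar_cycle R2 k2" "R1 \<theta> \<le> R2 \<theta>"
  shows "F_ray_at R1 \<theta> \<le> F_ray_at R2 \<theta>"
    and "R1 \<theta> < R2 \<theta> \<Longrightarrow> 0 < fst (on_ray R1 \<theta>) * Fx (fst (on_ray R1 \<theta>)) (snd (on_ray R1 \<theta>))
          + snd (on_ray R1 \<theta>) * Fy (fst (on_ray R1 \<theta>)) (snd (on_ray R1 \<theta>))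
       \<Longrightarrow> F_ray_at R1 \<theta> < F_ray_at R2 \<theta>"
proof -
  let ?l = "exp (R2 \<theta> - R1 \<theta>)"
  have scale: "?l * fst (on_ray R1 \<theta>) = fst (on_ray R2 \<theta>)" "?l * snd (on_ray R1 \<theta>) = snd (on_ray R2 \<theta>)"
    by (simp_all add: on_ray_def exp_diff)
  have dom: "fst (on_ray R1 \<theta>) \<in> {a<..<b}" "?l * fst (on_ray R1 \<theta>) \<in> {a<..<b}" "1 \<le> ?l"
    unfolding scale using assms by (simp_all add: polar_cycle_def del: greaterThanLessThan_iff)
  note ray = F_ray[OF dom(1,3,2), of "snd (on_ray R1 \<theta>)", unfolded scale]
  show "F_ray_at R1 \<theta> \<le> F_ray_at R2 \<theta>" using ray(1) by (simp add: F_ray_at_def)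
  assume "R1 \<theta> < R2 \<theta>" and "0 < fst (on_ray R1 \<theta>) * Fx (fst (on_ray R1 \<theta>)) (snd (on_ray R1 \<theta>))
          + snd (on_ray R1 \<theta>) * Fy (fst (on_ray R1 \<theta>)) (snd (on_ray R1 \<theta>))"
  then show "F_ray_at R1 \<theta> < F_ray_at R2 \<theta>" using ray(2) by (simp add: F_ray_at_def)
qed

lemma polar_cycle_unique:
  assumes 1: "polar_cycle R1 k1" and 2: "polar_cycle R2 k2"
  shows "R1 = R2"
proof -
  define K where "K R \<theta> = - (sin \<theta>)\<^sup>2 * F_ray_at R \<theta> / (1 - sin \<theta> * cos \<theta> * F_ray_at R \<theta>)" for R \<theta>
  let ?d = "\<lambda>\<theta>. R1 \<theta> - R2 \<theta>"
  have K_diff: "K R \<theta> - K S \<theta> = - (sin \<theta>)\<^sup>2 * (F_ray_at R \<theta> - F_ray_at S \<theta>) /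
      ((1 - sin \<theta> * cos \<theta> * F_ray_at R \<theta>) * (1 - sin \<theta> * cos \<theta> * F_ray_at S \<theta>))"
    and D_pos: "(1 - sin \<theta> * cos \<theta> * F_ray_at R \<theta>) * (1 - sin \<theta> * cos \<theta> * F_ray_at S \<theta>) > 0"
    if "polar_cycle R k" "polar_cycle S l" for R S k l \<theta>
  proof -
    have pos: "0 < 1 - sin \<theta> * cos \<theta> * F_ray_at R \<theta>" "0 < 1 - sin \<theta> * cos \<theta> * F_ray_at S \<theta>"
      using that by (auto simp: polar_cycle_def)
    then show "(1 - sin \<theta> * cos \<theta> * F_ray_at R \<theta>) * (1 - sin \<theta> * cos \<theta> * F_ray_at S \<theta>) > 0" by simp
    \<comment> \<open>Over the common denominator the terms in p q u v cancel, which leaves a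
      multiple of u - v.\<close>
    have "- q * u / (1 - p * u) - - q * v / (1 - p * v) = - q * (u - v) / ((1 - p * u) * (1 - p * v))"
      if "0 < 1 - p * u" "0 < 1 - p * v" for p q u v :: real
    proof -
      have ne: "1 - p * u \<noteq> 0" "1 - p * v \<noteq> 0" using that by auto
      have "- q * u * (1 - p * v) - - q * v * (1 - p * u) = - q * (u - v)"
        by (simp add: algebra_simps)
      then show ?thesis by (simp only: diff_frac_eq[OF ne])
    qed
    from this[OF pos]
    show "K R \<theta> - K S \<theta> = - (sin \<theta>)\<^sup>2 * (F_ray_at R \<theta> - F_ray_at S \<theta>) /
      ((1 - sin \<theta> * cos \<theta> * F_ray_at R \<theta>) * (1 - sin \<theta> * cos \<theta> * F_ray_at S \<theta>))" unfolding K_def .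
  qed
  have K_le: "K S \<theta> \<le> K R \<theta>" if "polar_cycle R k" "polar_cycle S l" "R \<theta> \<le> S \<theta>" for R S k l \<theta>
  proof -
    have "0 \<le> (sin \<theta>)\<^sup>2 * (F_ray_at S \<theta> - F_ray_at R \<theta>)"
      using F_ray_at_mono(1)[OF that] by simp
    then have "K S \<theta> - K R \<theta> \<le> 0"
      unfolding K_diff[OF that(2,1)] using D_pos[OF that(2,1), of \<theta>]
      by (simp add: divide_le_0_iff del: mult_le_0_iff)
    then show ?thesis by simp
  qed
  have deriv: "(R has_real_derivative K R \<theta>) (at \<theta>)" if "polar_cycle R k" for R k \<theta>
    using that by (simp add: polar_cycle_def K_def)
  have dd: "(?d has_real_derivative K R1 \<theta> - K R2 \<theta>) (at \<theta>)" for \<theta>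
    by (intro derivative_intros deriv[OF 1] deriv[OF 2])
  have dsq: "((\<lambda>\<theta>. (?d \<theta>)\<^sup>2) has_real_derivative 2 * ?d \<theta> * (K R1 \<theta> - K R2 \<theta>)) (at \<theta>)" for \<theta>
    by (rule DERIV_cong[OF DERIV_power[OF dd, of 2]]) simp
  have sign: "?d \<theta> * (K R1 \<theta> - K R2 \<theta>) \<le> 0" for \<theta>
  proof (cases "R1 \<theta> \<le> R2 \<theta>")
    case True
    then show ?thesis using K_le[OF 1 2 True] by (intro mult_nonpos_nonneg) auto
  next
    case False
    then show ?thesis using K_le[OF 2 1, of \<theta>] by (intro mult_nonneg_nonpos) auto
  qed
  have mono: "- (?d s)\<^sup>2 \<le> - (?d t)\<^sup>2" if "s \<le> t" for s t
  proof (rule DERIV_nonneg_imp_nondecreasing[where f = "\<lambda>\<theta>. - (?d \<theta>)\<^sup>2", OF that])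
    fix \<theta>
    have "0 \<le> - (2 * ?d \<theta> * (K R1 \<theta> - K R2 \<theta>))" using sign[of \<theta>] by linarith
    then show "\<exists>D. ((\<lambda>\<theta>. - (?d \<theta>)\<^sup>2) has_real_derivative D) (at \<theta>) \<and> 0 \<le> D"
      using DERIV_minus[OF dsq] by blast
  qed
  \<comment> \<open>A common multiple of the two periods, since the winding numbers may
    differ.\<close>
  let ?P = "2 * pi * real k1 * real k2"
  have P: "R (\<theta> + 2 * pi * real k * real n) = R \<theta>" if "polar_cycle R k" for R k \<theta> n
  proof -
    interpret periodic_fun_simple R "2 * pi * real k"
      using that by unfold_locales (simp add: polar_cycle_def)
    show ?thesis using plus_of_nat[of \<theta> n] by (simp add: mult_ac)
  qed
  have "?P > 0" using 1 2 by (simp add: polar_cycle_def)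
  moreover have "- (?d (\<theta> + ?P))\<^sup>2 = - (?d \<theta>)\<^sup>2" for \<theta>
    using P[OF 1, of \<theta> k2] P[OF 2, of \<theta> k1] by (simp add: mult_ac)
  ultimately have sq_const: "- (?d s)\<^sup>2 = - (?d t)\<^sup>2" for s t
    using nondecreasing_periodic_constant[of "\<lambda>\<theta>. - (?d \<theta>)\<^sup>2" ?P s t] mono by blast
  have d_zero: "?d \<theta> * (K R1 \<theta> - K R2 \<theta>) = 0" for \<theta>
  proof -
    have "(\<lambda>\<theta>. (?d \<theta>)\<^sup>2) = (\<lambda>_. (?d 0)\<^sup>2)"
    proof
      show "(?d \<theta>)\<^sup>2 = (?d 0)\<^sup>2" for \<theta> using sq_const[of \<theta> 0] by simp
    qed
    then have "((\<lambda>\<theta>. (?d \<theta>)\<^sup>2) has_real_derivative 0) (at \<theta>)" by simp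
    from DERIV_unique[OF dsq this] have "2 * ?d \<theta> * (K R1 \<theta> - K R2 \<theta>) = 0" .
    then show ?thesis by simp
  qed
  show ?thesis
  proof (rule ccontr)
    assume "R1 \<noteq> R2"
    \<comment> \<open>The square of the gap is constant, so one zero would make the two graphs
      equal. With the gap nowhere zero, \<open>d_zero\<close> yields equal slopes, and then the gap
      itself is constant with a fixed sign.\<close>
    have nz: "?d \<theta> \<noteq> 0" for \<theta>
    proof
      assume "?d \<theta> = 0"
      then have "?d s = 0" for s using sq_const[of s \<theta>] by simp
      then show False using \<open>R1 \<noteq> R2\<close> by (simp add: fun_eq_iff)
    qed
    have K_eq: "K R1 \<theta> = K R2 \<theta>" for \<theta> using d_zero[of \<theta>] nz[of \<theta>] by simp
    then have d_const: "?d s = ?d t" for s t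
      using DERIV_isconst_all[of ?d s t] dd by simp
    \<comment> \<open>Stated for a generic inner graph \<open>R\<close> and outer graph
      \<open>S\<close>, to serve both signs of the gap. At the strict point of the inner graph
      \<open>F\<close> differs and sin \<theta> is nonzero, so the slopes differ.\<close>
    have contra: False if R: "polar_cycle R k" "polar_cycle S l"
      and less: "\<And>\<theta>. R \<theta> < S \<theta>" and eq: "\<And>\<theta>. K S \<theta> = K R \<theta>" for R S k l
    proof -
      obtain \<theta> where \<theta>: "snd (on_ray R \<theta>) \<noteq> 0" "0 < fst (on_ray R \<theta>) * Fx (fst (on_ray R \<theta>)) (snd (on_ray R \<theta>))
          + snd (on_ray R \<theta>) * Fy (fst (on_ray R \<theta>)) (snd (on_ray R \<theta>))"
        using R(1) by (auto simp: polar_cycle_def)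
      have "F_ray_at R \<theta> < F_ray_at S \<theta>"
        using F_ray_at_mono(2)[OF R _ less \<theta>(2)] less[of \<theta>] by simp
      moreover have "sin \<theta> \<noteq> 0" using \<theta>(1) by (simp add: on_ray_def)
      ultimately show False
        using K_diff[OF R(2,1), of \<theta>] D_pos[OF R(2,1), of \<theta>] eq[of \<theta>] by auto
    qed
    show False
    proof (cases "?d 0 < 0")
      case True
      then have "?d \<theta> < 0" for \<theta> using d_const[of \<theta> 0] by simp
      then show False using contra[OF 1 2] K_eq by simp
    next
      case False
      then have "?d \<theta> > 0" for \<theta> using d_const[of \<theta> 0] nz[of 0] by simp
      then show False using contra[OF 2 1] K_eq by simp
    qed
  qed
qed

end

section \<open>From a periodic solution to its polar graph\<close>

context lienard_cycle
begin

lemma polar_form: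
  obtains R k where "polar_cycle R k" "range (\<lambda>t. (x t, y t)) = range (on_ray R)"
proof -
  let ?F = "\<lambda>t. F (x t) (y t)"
  let ?r2 = "\<lambda>t. (x t)\<^sup>2 + (y t)\<^sup>2"
  \<comment> \<open>The conjugate of x + i y is used so that the clockwise rotation becomes an
    increasing argument.\<close>
  let ?z = "\<lambda>t. Complex (x t) (- y t)" and ?z' = "\<lambda>t. Complex (y t) (x t + y t * ?F t)"
  have z: "(?z has_vector_derivative ?z' t) (at t)" for t
    using x_derivative[of t] DERIV_minus[OF y_derivative[of t]]
    by (simp add: has_vector_derivative_complex_iff add.commute)
  have z': "isCont ?z' t" for t
    unfolding Complex_eq by (intro continuous_intros isCont_x isCont_y isCont_F)
  have nz: "?z t \<noteq> 0" for t
    using not_origin[of t] by (auto simp: complex_eq_iff)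
  obtain L where L: "\<And>t. exp (L t) = ?z t" "\<And>t. (L has_vector_derivative ?z' t / ?z t) (at t)"
    using logarithm_along_path[OF z z' nz] by blast
  define \<rho> \<phi> where "\<rho> = (\<lambda>t. Re (L t))" and "\<phi> = (\<lambda>t. Im (L t))"
  have "exp (L t) = Complex (exp (\<rho> t) * cos (\<phi> t)) (exp (\<rho> t) * sin (\<phi> t))" for t
    by (simp add: complex_eq_iff Re_exp Im_exp \<rho>_def \<phi>_def)
  then have xy: "x t = exp (\<rho> t) * cos (\<phi> t)" "y t = - exp (\<rho> t) * sin (\<phi> t)" for t
    using L(1)[of t] by simp_all
  have r2: "?r2 t = (exp (\<rho> t))\<^sup>2" for t
  proof -
    have "?r2 t = (exp (\<rho> t))\<^sup>2 * ((cos (\<phi> t))\<^sup>2 + (sin (\<phi> t))\<^sup>2)"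
      unfolding xy by (simp add: power_mult_distrib algebra_simps del: sin_cos_squared_add sin_cos_squared_add2)
    then show ?thesis by simp
  qed
  have \<rho>: "(\<rho> has_real_derivative - (sin (\<phi> t))\<^sup>2 * ?F t) (at t)" for t
  proof -
    have "Re (?z' t / ?z t) = - (y t)\<^sup>2 * ?F t / ?r2 t"
      by (simp add: Re_divide power2_eq_square algebra_simps)
    also have "\<dots> = - (sin (\<phi> t))\<^sup>2 * ?F t"
      unfolding r2 by (simp add: xy(2) power_mult_distrib)
    finally show ?thesis
      using L(2)[of t] unfolding has_vector_derivative_complex_iff \<rho>_def by simp
  qed
  let ?w = "\<lambda>t. 1 - sin (\<phi> t) * cos (\<phi> t) * ?F t"
  \<comment> \<open>Two forms of the angular velocity: the left one shows that it is positive, the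
    right one enters the polar equation.\<close>
  have w: "S t / ?r2 t = ?w t" for t
  proof -
    have "S t / ?r2 t = 1 + x t * y t * ?F t / ?r2 t"
      using not_origin[of t] unfolding S_def by (subst add_divide_distrib) auto
    also have "x t * y t * ?F t / ?r2 t = - sin (\<phi> t) * cos (\<phi> t) * ?F t"
      unfolding r2 by (simp add: xy power2_eq_square)
    finally show ?thesis by simp
  qed
  have w_pos: "0 < ?w t" for t
    using divide_pos_pos[OF S_pos[of t] not_origin[of t]] unfolding w .
  have \<phi>: "(\<phi> has_real_derivative ?w t) (at t)" for t
  proof -
    have "Im (?z' t / ?z t) = S t / ?r2 t"
      by (simp add: Im_divide S_def power2_eq_square algebra_simps)
    then show ?thesis
      using L(2)[of t] unfolding has_vector_derivative_complex_iff \<phi>_def w by simp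
  qed
  have \<phi>_less: "\<phi> s < \<phi> t" if "s < t" for s t
    using that \<phi> w_pos by (intro DERIV_pos_imp_increasing[where f = \<phi>]) blast+
  have \<rho>_periodic: "\<rho> (t + T) = \<rho> t" for t
    using r2[of "t + T"] r2[of t] by (simp add: x_periodic y_periodic)
  \<comment> \<open>The angle gained over one period is a multiple of 2 pi because exp(L) is
    periodic. It is independent of \<open>t\<close> because the angular velocity is periodic, and
    positive because the angle increases.\<close>
  obtain k :: nat where k: "k > 0" "\<And>t. \<phi> (t + T) = \<phi> t + 2 * pi * real k"
  proof -
    define h where "h t = (\<phi> (t + T) - \<phi> t) / (2 * pi)" for t
    have h_int: "h t \<in> \<int>" for t
    proof -
      have "exp (L (t + T)) = exp (L t)" by (simp add: L(1) x_periodic y_periodic)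
      then obtain n :: int where "L (t + T) = L t + (of_int (2 * n) * pi) * \<i>"
        unfolding exp_eq by blast
      then have "\<phi> (t + T) = \<phi> t + 2 * of_int n * pi" by (simp add: \<phi>_def)
      then have "h t = of_int n" by (simp add: h_def)
      then show ?thesis by simp
    qed
    have "(h has_real_derivative 0) (at t)" for t
    proof -
      have "?w (t + T) = S (t + T) / ?r2 (t + T)" by (rule w[symmetric])
      also have "\<dots> = ?w t" unfolding S_periodic x_periodic y_periodic by (rule w)
      finally show ?thesis
        using DERIV_cdivide[OF DERIV_diff[OF \<phi>[of "t + T", unfolded DERIV_shift] \<phi>[of t]], of "2 * pi"]
        unfolding h_def[abs_def] by simp
    qed
    then have c: "h s = h t" for s t using DERIV_isconst_all by blast
    have "h 0 > 0" using \<phi>_less[of 0 T] T_pos by (simp add: h_def)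
    moreover obtain n :: int where n: "h 0 = of_int n" using h_int by (auto elim: Ints_cases)
    ultimately have "n > 0" by simp
    have "\<phi> (t + T) = \<phi> t + 2 * pi * real (nat n)" for t
    proof -
      have "h t = real (nat n)" using c[of t 0] n \<open>n > 0\<close> by simp
      then show ?thesis by (simp add: h_def field_simps)
    qed
    then show thesis using that[of "nat n"] \<open>n > 0\<close> by simp
  qed
  \<comment> \<open>Time as a function of the angle. The chain rule then divides the derivative of
    \<open>\<rho>\<close> by the angular velocity, which gives the polar equation.\<close>
  obtain \<psi> where \<psi>: "\<And>\<theta>. \<phi> (\<psi> \<theta>) = \<theta>" "\<And>t. \<psi> (\<phi> t) = t"
    "\<And>\<theta>. (\<psi> has_real_derivative inverse (?w (\<psi> \<theta>))) (at \<theta>)"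
    using strictly_increasing_shift_bij[OF \<phi> w_pos k(2) T_pos] by blast
  define R where "R = (\<lambda>\<theta>. \<rho> (\<psi> \<theta>))"
  have ray: "on_ray R \<theta> = (x (\<psi> \<theta>), y (\<psi> \<theta>))" for \<theta>
    by (simp add: on_ray_def R_def xy \<psi>(1))
  have F_R: "F_ray_at R \<theta> = ?F (\<psi> \<theta>)" for \<theta> by (simp add: F_ray_at_def ray)
  have "\<psi> (\<theta> + 2 * pi * real k) = \<psi> \<theta> + T" for \<theta>
    using k(2)[of "\<psi> \<theta>"] \<psi>(1,2) by metis
  then have "R (\<theta> + 2 * pi * real k) = R \<theta>" for \<theta> by (simp add: R_def \<rho>_periodic)
  moreover have "(R has_real_derivative
       - (sin \<theta>)\<^sup>2 * F_ray_at R \<theta> / (1 - sin \<theta> * cos \<theta> * F_ray_at R \<theta>)) (at \<theta>)" for \<theta>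
    unfolding F_R using DERIV_chain2[OF \<rho> \<psi>(3)] by (simp add: R_def \<psi>(1) divide_inverse)
  moreover have "0 < 1 - sin \<theta> * cos \<theta> * F_ray_at R \<theta>" for \<theta>
    using w_pos[of "\<psi> \<theta>"] by (simp add: F_R \<psi>(1))
  moreover obtain t where "y t \<noteq> 0" "radial_growth t > 0" by (rule strict_point)
  then have "snd (on_ray R (\<phi> t)) \<noteq> 0 \<and> 0 < fst (on_ray R (\<phi> t)) * Fx (fst (on_ray R (\<phi> t))) (snd (on_ray R (\<phi> t)))
          + snd (on_ray R (\<phi> t)) * Fy (fst (on_ray R (\<phi> t))) (snd (on_ray R (\<phi> t)))"
    by (simp add: ray \<psi>(2) radial_growth_def)
  ultimately have "polar_cycle R k"
    using k(1) x_in unfolding polar_cycle_def ray fst_conv snd_conv by blast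
  moreover have "range (\<lambda>t. (x t, y t)) = range (on_ray R)"
  proof (intro equalityI subsetI)
    fix p assume "p \<in> range (\<lambda>t. (x t, y t))"
    then obtain t where "p = (x t, y t)" by blast
    then have "p = on_ray R (\<phi> t)" by (simp add: ray \<psi>(2))
    then show "p \<in> range (on_ray R)" by blast
  next
    fix p assume "p \<in> range (on_ray R)"
    then show "p \<in> range (\<lambda>t. (x t, y t))" unfolding ray by blast
  qed
  ultimately show thesis by (rule that)
qed

end

section \<open>Uniqueness and hyperbolicity for cycles as point sets\<close>

context lienard_system
begin

lemma lienard_cycle_of_param:
  assumes "periodic_cycle_param (\<lambda>x y. y) (\<lambda>x y. - x - y * F x y) ({a<..<b} \<times> UNIV) T \<gamma>"
  shows "lienard_cycle a b F Fx Fy X (\<lambda>t. fst (\<gamma> t)) (\<lambda>t. snd (\<gamma> t)) T"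
proof unfold_locales
  note sol = assms[unfolded periodic_cycle_param_def planar_solution_def]
  have D: "(\<gamma> has_vector_derivative (snd (\<gamma> t), - fst (\<gamma> t) - snd (\<gamma> t) * F (fst (\<gamma> t)) (snd (\<gamma> t)))) (at t)" for t
    using sol by blast
  show "((\<lambda>t. fst (\<gamma> t)) has_real_derivative snd (\<gamma> t)) (at t)" for t
    using bounded_linear.has_vector_derivative[OF bounded_linear_fst D]
    by (simp add: has_real_derivative_iff_has_vector_derivative)
  show "((\<lambda>t. snd (\<gamma> t)) has_real_derivative - fst (\<gamma> t) - snd (\<gamma> t) * F (fst (\<gamma> t)) (snd (\<gamma> t))) (at t)" for t
    using bounded_linear.has_vector_derivative[OF bounded_linear_snd D]
    by (simp add: has_real_derivative_iff_has_vector_derivative)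
  show "fst (\<gamma> t) \<in> {a<..<b}" for t using sol by (auto simp: mem_Times_iff)
  show "T > 0" "fst (\<gamma> (t + T)) = fst (\<gamma> t)" "snd (\<gamma> (t + T)) = snd (\<gamma> t)" for t
    using sol by auto
  show "\<exists>s t. (fst (\<gamma> s), snd (\<gamma> s)) \<noteq> (fst (\<gamma> t), snd (\<gamma> t))"
    unfolding prod.collapse using sol unfolding constant_on_def by blast
qed

lemma planar_divergence_eq:
  assumes "u \<in> {a<..<b}"
  shows "planar_divergence (\<lambda>x y. y) (\<lambda>x y. - x - y * F x y) (u, v) = - (F u v + v * Fy u v)"
proof -
  have "((\<lambda>y. F u y) has_real_derivative Fy u v) (at v)"
    using F_along[of "\<lambda>_. u" v 0 "\<lambda>y. y" 1] assms by simp
  then have "((\<lambda>y. - u - y * F u y) has_real_derivative - (F u v + v * Fy u v)) (at v)"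
    by (auto intro!: derivative_eq_intros)
  then show ?thesis by (simp add: planar_divergence_def DERIV_imp_deriv)
qed

text \<open>Each cycle is the range of a polar graph, and there is only one such graph whatever the
  parametrisation and the period.\<close>

lemma cycle_unique:
  assumes "is_cycle (\<lambda>x y. y) (\<lambda>x y. - x - y * F x y) ({a<..<b} \<times> UNIV) C1"
    and "is_cycle (\<lambda>x y. y) (\<lambda>x y. - x - y * F x y) ({a<..<b} \<times> UNIV) C2"
  shows "C1 = C2"
proof -
  have polar: "\<exists>R k. polar_cycle R k \<and> C = range (on_ray R)"
    if "is_cycle (\<lambda>x y. y) (\<lambda>x y. - x - y * F x y) ({a<..<b} \<times> UNIV) C" for C
  proof -
    obtain T \<gamma> where "periodic_cycle_param (\<lambda>x y. y) (\<lambda>x y. - x - y * F x y) ({a<..<b} \<times> UNIV) T \<gamma>"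
      and C: "C = range \<gamma>"
      using \<open>is_cycle _ _ _ C\<close> by (auto simp: is_cycle_def)
    then interpret lienard_cycle a b F Fx Fy X "\<lambda>t. fst (\<gamma> t)" "\<lambda>t. snd (\<gamma> t)" T
      by (intro lienard_cycle_of_param)
    obtain R k where "polar_cycle R k" "range (\<lambda>t. (fst (\<gamma> t), snd (\<gamma> t))) = range (on_ray R)"
      by (rule polar_form)
    then show ?thesis using C by auto
  qed
  obtain R1 k1 R2 k2 where R: "polar_cycle R1 k1" "C1 = range (on_ray R1)"
    "polar_cycle R2 k2" "C2 = range (on_ray R2)"
    using polar[OF assms(1)] polar[OF assms(2)] by blast
  then show ?thesis using polar_cycle_unique[OF R(1,3)] by simp
qed

lemma cycle_hyperbolic:
  assumes "is_cycle (\<lambda>x y. y) (\<lambda>x y. - x - y * F x y) ({a<..<b} \<times> UNIV) C"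
  shows "is_hyperbolic_cycle (\<lambda>x y. y) (\<lambda>x y. - x - y * F x y) ({a<..<b} \<times> UNIV) C"
  unfolding is_hyperbolic_cycle_def
proof (intro conjI allI impI)
  fix T \<gamma>
  assume "periodic_cycle_param (\<lambda>x y. y) (\<lambda>x y. - x - y * F x y) ({a<..<b} \<times> UNIV) T \<gamma> \<and> range \<gamma> = C"
  then interpret lienard_cycle a b F Fx Fy X "\<lambda>t. fst (\<gamma> t)" "\<lambda>t. snd (\<gamma> t)" T
    by (intro lienard_cycle_of_param) simp
  have "planar_divergence (\<lambda>x y. y) (\<lambda>x y. - x - y * F x y) (\<gamma> t) = divergence t" for t
    using planar_divergence_eq[OF x_in, of t "snd (\<gamma> t)"] by (simp add: divergence_def)
  then show "integral {0..T} (\<lambda>t. planar_divergence (\<lambda>x y. y) (\<lambda>x y. - x - y * F x y) (\<gamma> t)) \<noteq> 0"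
    using divergence_integral_neg by simp
qed (rule assms)

end

section \<open>Damping polynomial in y\<close>

theorem corollary2:
  fixes a b :: real and N J :: nat and f :: "nat \<Rightarrow> real \<Rightarrow> real"
    and P Q :: "real \<Rightarrow> real \<Rightarrow> real" and D :: "(real \<times> real) set"
  assumes ab: "a < 0" "0 < b"
    and J_eq: "J = 2 * N + 1"
    and C1: "\<And>j. j \<in> {1..J} \<Longrightarrow> f j C1_differentiable_on {a<..<b}"
    and even_zero: "\<And>j x. j \<in> {1..J} \<Longrightarrow> even j \<Longrightarrow> x \<in> {a<..<b} \<Longrightarrow> f j x = 0"
    and odd_nonneg: "\<And>j x. j \<in> {1..J} \<Longrightarrow> odd j \<Longrightarrow> x \<in> {a<..<b} \<Longrightarrow>
          x * deriv (f j) x + (real j - 1) * f j x \<ge> 0"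
    and seq: "\<exists>X :: nat \<Rightarrow> real. (\<forall>m. X m \<in> {a<..<b}) \<and> X \<longlonglongrightarrow> 0 \<and>
          (\<forall>m. \<exists>j\<in>{1..J}. X m * deriv (f j) (X m) + (real j - 1) * f j (X m) \<noteq> 0)"
    and P_eq: "P = (\<lambda>x y. y)"
    and Q_eq: "Q = (\<lambda>x y. - x - y * (\<Sum>k=0..N. f (2 * k + 1) x * y ^ (2 * k)))"
    and D_eq: "D = {a<..<b} \<times> UNIV"
  shows "(\<exists>\<^sub>\<le>\<^sub>1C. is_limit_cycle P Q D C) \<and>
         (\<forall>C. is_limit_cycle P Q D C \<longrightarrow> is_hyperbolic_cycle P Q D C)"
proof -
  let ?I = "{a<..<b}"
  define F where "F = (\<lambda>u v. \<Sum>k=0..N. f (2 * k + 1) u * v ^ (2 * k))"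
  define Fx where "Fx = (\<lambda>u v. \<Sum>k=0..N. deriv (f (2 * k + 1)) u * v ^ (2 * k))"
  \<comment> \<open>For k = 0 the exponent \<open>2 * k - 1\<close> truncates to 0, but the factor
    \<open>real (2 * k)\<close> makes the term vanish.\<close>
  define Fy where "Fy = (\<lambda>u v. \<Sum>k=0..N. f (2 * k + 1) u * (real (2 * k) * v ^ (2 * k - 1)))"
  have index: "2 * k + 1 \<in> {1..J}" if "k \<in> {0..N}" for k using that J_eq by simp
  have f_deriv: "(f j has_real_derivative deriv (f j) u) (at u)" if j: "j \<in> {1..J}" and u: "u \<in> ?I" for j u
  proof -
    obtain d where "(f j has_real_derivative d) (at u)"
      using C1[OF j] u unfolding C1_differentiable_on_def has_real_derivative_iff_has_vector_derivative by blast
    then show ?thesis by (simp add: DERIV_imp_deriv)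
  qed
  \<comment> \<open>With j = 2k + 1 the coefficient of v^(2k) in the radial derivative is exactly
    the quantity in the hypotheses, and the even powers preserve its sign.\<close>
  have radial: "u * Fx u v + v * Fy u v =
      (\<Sum>k=0..N. (u * deriv (f (2 * k + 1)) u + (real (2 * k + 1) - 1) * f (2 * k + 1) u) * v ^ (2 * k))" for u v
    unfolding Fx_def Fy_def sum_distrib_left sum.distrib[symmetric]
  proof (rule sum.cong)
    fix k
    have power: "v * (real (2 * k) * v ^ (2 * k - 1)) = real (2 * k) * v ^ (2 * k)"
      by (cases k) simp_all
    have "v * (f (2 * k + 1) u * (real (2 * k) * v ^ (2 * k - 1))) = f (2 * k + 1) u * (real (2 * k) * v ^ (2 * k))"
      unfolding power[symmetric] by (rule mult.left_commute)
    then show "u * (deriv (f (2 * k + 1)) u * v ^ (2 * k)) + v * (f (2 * k + 1) u * (real (2 * k) * v ^ (2 * k - 1))) =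
      (u * deriv (f (2 * k + 1)) u + (real (2 * k + 1) - 1) * f (2 * k + 1) u) * v ^ (2 * k)"
      by (simp add: algebra_simps)
  qed simp
  have term_nonneg: "0 \<le> (u * deriv (f (2 * k + 1)) u + (real (2 * k + 1) - 1) * f (2 * k + 1) u) * v ^ (2 * k)"
    if "k \<in> {0..N}" "u \<in> ?I" for k u v
    using odd_nonneg[OF index[OF that(1)] _ that(2)] by (intro mult_nonneg_nonneg) auto
  obtain X where X: "\<And>m. X m \<in> ?I" "X \<longlonglongrightarrow> 0"
    "\<And>m. \<exists>j\<in>{1..J}. X m * deriv (f j) (X m) + (real j - 1) * f j (X m) \<noteq> 0"
    using seq by blast
  interpret lienard_system a b F Fx Fy X
  proof
    show "((\<lambda>p. F (fst p) (snd p)) has_derivative (\<lambda>h. Fx u v * fst h + Fy u v * snd h)) (at (u, v))"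
      if u: "u \<in> ?I" for u v
    proof -
      have "((\<lambda>p. f (2 * k + 1) (fst p) * snd p ^ (2 * k)) has_derivative
        (\<lambda>h. deriv (f (2 * k + 1)) u * v ^ (2 * k) * fst h
          + f (2 * k + 1) u * (real (2 * k) * v ^ (2 * k - 1)) * snd h)) (at (u, v))"
        if k: "k \<in> {0..N}" for k
      proof -
        have "((\<lambda>p. f (2 * k + 1) (fst p)) has_derivative (\<lambda>h. deriv (f (2 * k + 1)) u * fst h)) (at (u, v))"
          using f_deriv[OF index[OF k] u] unfolding has_field_derivative_def
          by (intro has_derivative_compose[OF has_derivative_fst[OF has_derivative_ident]]) simp
        moreover have "((\<lambda>p. snd p ^ (2 * k)) has_derivative (\<lambda>h. real (2 * k) * v ^ (2 * k - 1) * snd h)) (at (u, v))"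
          by (auto intro!: derivative_eq_intros)
        ultimately show ?thesis
          by (rule has_derivative_eq_rhs[OF has_derivative_mult]) (simp add: algebra_simps)
      qed
      then have "((\<lambda>p. \<Sum>k=0..N. f (2 * k + 1) (fst p) * snd p ^ (2 * k)) has_derivative
        (\<lambda>h. \<Sum>k=0..N. deriv (f (2 * k + 1)) u * v ^ (2 * k) * fst h
          + f (2 * k + 1) u * (real (2 * k) * v ^ (2 * k - 1)) * snd h)) (at (u, v))"
        by (rule has_derivative_sum)
      then show ?thesis
        unfolding F_def Fx_def Fy_def by (simp only: sum_distrib_right sum.distrib)
    qed
    have "continuous_on ?I (f (2 * k + 1))" if "k \<in> {0..N}" for k
      using f_deriv[OF index[OF that]] DERIV_isCont by (blast intro: continuous_at_imp_continuous_on)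
    then have "continuous_on (?I \<times> UNIV) (\<lambda>p. f (2 * k + 1) (fst p))" if "k \<in> {0..N}" for k
      using that by (intro continuous_on_compose2[of ?I "f (2 * k + 1)" "?I \<times> UNIV" fst] continuous_intros) auto
    then show "continuous_on (?I \<times> UNIV) (\<lambda>p. Fy (fst p) (snd p))"
      unfolding Fy_def by (intro continuous_intros)
    show "0 \<le> u * Fx u v + v * Fy u v" if "u \<in> ?I" for u v
      unfolding radial using term_nonneg that by (intro sum_nonneg) blast
    show "0 < X m * Fx (X m) v + v * Fy (X m) v" if "v \<noteq> 0" for m v
    proof -
      obtain j where j: "j \<in> {1..J}" "X m * deriv (f j) (X m) + (real j - 1) * f j (X m) \<noteq> 0"
        using X(3) by blast
      \<comment> \<open>For even \<open>j\<close> the function vanishes on the whole open interval,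
        so its derivative vanishes too and the quantity at \<open>X m\<close> would be zero.\<close>
      have "odd j"
      proof
        assume "even j"
        then have zero: "\<And>x. x \<in> ?I \<Longrightarrow> f j x = 0" using even_zero j(1) by blast
        have "(f j has_real_derivative 0) (at (X m))"
          by (rule has_field_derivative_transform_within_open[where f = "\<lambda>_. 0" and S = ?I])
            (use X(1) zero in auto)
        then show False using j(2) zero[OF X(1)[of m]] by (simp add: DERIV_imp_deriv)
      qed
      then obtain k where k: "j = 2 * k + 1" by (elim oddE)
      then have kN: "k \<in> {0..N}" using j(1) J_eq by simp
      have "0 < X m * deriv (f j) (X m) + (real j - 1) * f j (X m)"
        using odd_nonneg[OF j(1) \<open>odd j\<close> X(1)[of m]] j(2) by simp
      moreover have "0 < v ^ (2 * k)" using that by (simp add: power_mult)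
      ultimately have "0 < (X m * deriv (f (2 * k + 1)) (X m) + (real (2 * k + 1) - 1) * f (2 * k + 1) (X m)) * v ^ (2 * k)"
        unfolding k by (rule mult_pos_pos)
      then show ?thesis
        unfolding radial using term_nonneg[OF _ X(1)] kN by (intro sum_pos2[of _ k]) blast+
    qed
  qed (use X(2) in auto)
  have Q: "Q = (\<lambda>x y. - x - y * F x y)" by (simp add: Q_eq F_def)
  \<comment> \<open>Both claims hold for all cycles, in particular for limit cycles.\<close>
  show ?thesis
    unfolding P_eq Q D_eq Uniq_def is_limit_cycle_def using cycle_unique cycle_hyperbolic by blast
qed

end
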